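(* Let $X$ be an Archimedean pre-Riesz space and let $P\colon X\to X$ be an order projection. Then $P$ is order continuous.
   Context: All vector spaces are real. An ordered vector space $X$ is a real vector space with a cone $X_+$ (closed under addition and multiplication by nonnegative scalars, $X_+\cap(-X_+)=\{0\}$), ordered by $x\le y$ iff $y-x\in X_+$. It is Archimedean if $nx\le y$ for all $n\in\mathbb N$ implies $x\le 0$. A linear subspace $D$ of an ordered vector space $Y$ is order dense in $Y$ if $y=\inf\{z\in D: y\le z\}$ for every $y\in Y$. An ordered vector space $X$ is a pre-Riesz space if there exist a vector lattice $Y$ and a bipositive linear map $i\colon X\to Y$ (i.e. $i(x)\ge 0$ iff $x\ge 0$) such that $i(X)$ is order dense in $Y$. For linear operators $S,T\colon X\to X$, $S\le T$ means $(T-S)(X_+)\subseteq X_+$. An order projection on $X$ is a linear operator $P\colon X\to X$ with $P^2=P$ and $0\le P\le I$, where $I$ is the identity operator. A net $(z_\alpha)$ satisfies $z_\alpha\downarrow 0$ if it is decreasing and $\inf_\alpha z_\alpha=0$. A net $(x_\alpha)$ in $X$ order converges to $x\in X$ if there is a net $(z_\alpha)$ in $X$ (with the same index set) with $z_\alpha\downarrow 0$ and $\pm(x-x_\alpha)\le z_\alpha$ for every $\alpha$. A linear operator $T\colon X\to X$ is order continuous if whenever a net $(x_\alpha)$ order converges to $x\in X$, the net $(T(x_\alpha))$ order converges to $T(x)$. *)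

theory Defs
  imports Complex_Main "HOL-Library.Lub_Glb"
begin

text \<open>
  Ordered vector spaces are types of class \<^class>\<open>ordered_real_vector\<close>, with positive cone
  \<open>{x. 0 \<le> x}\<close>; vector lattices are types of sort \<open>{ordered_real_vector, lattice}\<close>.
\<close>

definition archimedean :: "'x::ordered_real_vector itself \<Rightarrow> bool" where
  "archimedean _ \<longleftrightarrow> (\<forall>x y :: 'x. (\<forall>n::nat. real n *\<^sub>R x \<le> y) \<longrightarrow> x \<le> 0)"

definition order_dense :: "'y::ordered_real_vector set \<Rightarrow> bool" where
  "order_dense D \<longleftrightarrow> subspace D \<and> (\<forall>y. isGlb UNIV {z \<in> D. y \<le> z} y)"

definition bipositive :: "('x::ordered_real_vector \<Rightarrow> 'y::ordered_real_vector) \<Rightarrow> bool" where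
  "bipositive i \<longleftrightarrow> (\<forall>x. 0 \<le> i x \<longleftrightarrow> 0 \<le> x)"

text \<open>
  HOL cannot quantify existentially over the type of the ambient vector lattice, so that type is
  a second parameter. In a theorem assuming \<open>pre_Riesz TYPE('x) TYPE('y)\<close> with \<open>'y\<close> a free type
  variable not occurring in the conclusion, the outer quantification over \<open>'y\<close> amounts to
  assuming that some vector lattice \<open>'y\<close> with the required embedding exists.
\<close>

definition pre_Riesz ::
    "'x::ordered_real_vector itself \<Rightarrow> 'y::{ordered_real_vector, lattice} itself \<Rightarrow> bool" where
  "pre_Riesz _ _ \<longleftrightarrow> (\<exists>i :: 'x \<Rightarrow> 'y. linear i \<and> bipositive i \<and> order_dense (range i))"

definition operator_le ::
    "('x::ordered_real_vector \<Rightarrow> 'x) \<Rightarrow> ('x \<Rightarrow> 'x) \<Rightarrow> bool" where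
  "operator_le S T \<longleftrightarrow> (\<lambda>x. T x - S x) ` {x. 0 \<le> x} \<subseteq> {x. 0 \<le> x}"

definition order_projection :: "('x::ordered_real_vector \<Rightarrow> 'x) \<Rightarrow> bool" where
  "order_projection P \<longleftrightarrow>
     linear P \<and> P \<circ> P = P \<and> operator_le (\<lambda>_. 0) P \<and> operator_le P id"

definition directed_set :: "'i set \<Rightarrow> 'i rel \<Rightarrow> bool" where
  "directed_set A r \<longleftrightarrow>
     A \<noteq> {} \<and> preorder_on A r \<and> (\<forall>a\<in>A. \<forall>b\<in>A. \<exists>c\<in>A. (a, c) \<in> r \<and> (b, c) \<in> r)"

text \<open>
  A net is a function on the index type, of which only the values on the directed set \<open>(A, r)\<close>
  matter; \<open>(a, b) \<in> r\<close> means that \<open>b\<close> is the later index.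
\<close>

definition decreases_to_zero ::
    "'i set \<Rightarrow> 'i rel \<Rightarrow> ('i \<Rightarrow> 'x::ordered_real_vector) \<Rightarrow> bool" where
  "decreases_to_zero A r z \<longleftrightarrow>
     (\<forall>a\<in>A. \<forall>b\<in>A. (a, b) \<in> r \<longrightarrow> z b \<le> z a) \<and> isGlb UNIV (z ` A) 0"

definition order_converges ::
    "'i set \<Rightarrow> 'i rel \<Rightarrow> ('i \<Rightarrow> 'x::ordered_real_vector) \<Rightarrow> 'x \<Rightarrow> bool" where
  "order_converges A r f x \<longleftrightarrow>
     (\<exists>z. decreases_to_zero A r z \<and> (\<forall>a\<in>A. x - f a \<le> z a \<and> - (x - f a) \<le> z a))"

text \<open>
  HOL cannot quantify inside a definition over all types of indices, so the index type is a
  parameter; a theorem concluding \<open>order_continuous TYPE('i) T\<close> for a free type variable \<open>'i\<close>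
  covers all nets.
\<close>

definition order_continuous ::
    "'i itself \<Rightarrow> ('x::ordered_real_vector \<Rightarrow> 'x) \<Rightarrow> bool" where
  "order_continuous _ T \<longleftrightarrow> linear T \<and>
     (\<forall>(A :: 'i set) r f x. directed_set A r \<longrightarrow> order_converges A r f x \<longrightarrow>
        order_converges A r (\<lambda>a. T (f a)) (T x))"

end

theory Submission
  imports Defs
begin

text \<open>
  Since \<open>P\<close> is positive, applying it to \<open>\<plusminus>(x - x\<^sub>\<alpha>) \<le> z\<^sub>\<alpha>\<close> gives \<open>\<plusminus>(P x - P x\<^sub>\<alpha>) \<le> P z\<^sub>\<alpha>\<close>.
  As \<open>z\<^sub>\<alpha>\<close> is positive and \<open>P \<le> I\<close>, also \<open>P z\<^sub>\<alpha> \<le> z\<^sub>\<alpha>\<close>. So the net \<open>z\<^sub>\<alpha>\<close> that witnesses the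
  order convergence of \<open>x\<^sub>\<alpha>\<close> to \<open>x\<close> also witnesses that of \<open>P x\<^sub>\<alpha>\<close> to \<open>P x\<close>.
\<close>

lemma decreases_to_zero_nonneg:
  assumes "decreases_to_zero A r z" "a \<in> A"
  shows "0 \<le> z a"
  using assms
  by (auto simp: decreases_to_zero_def isGlb_def greatestP_def isLb_def setge_def)

lemma linear_positive_mono:
  assumes "linear T" "operator_le (\<lambda>_. 0) T" "u \<le> v"
  shows "T u \<le> T v"
proof -
  have "0 \<le> T (v - u)"
    using assms(2,3) by (auto simp: operator_le_def image_subset_iff)
  then show ?thesis
    using assms(1) by (simp add: linear_diff)
qed

lemma order_continuous_if_between_zero_and_id:
  fixes T :: "'x::ordered_real_vector \<Rightarrow> 'x"
  assumes lin: "linear T" and pos: "operator_le (\<lambda>_. 0) T" and le_id: "operator_le T id"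
  shows "order_continuous TYPE('i) T"
  unfolding order_continuous_def
proof (intro conjI allI impI)
  show "linear T" by (fact lin)
next
  fix A :: "'i set" and r and f :: "'i \<Rightarrow> 'x" and x :: 'x
  assume "order_converges A r f x"
  then obtain z where z: "decreases_to_zero A r z"
    and bound: "\<forall>a\<in>A. x - f a \<le> z a \<and> - (x - f a) \<le> z a"
    by (auto simp: order_converges_def)
  have "T x - T (f a) \<le> z a \<and> - (T x - T (f a)) \<le> z a" if a: "a \<in> A" for a
  proof -
    have "T (z a) \<le> z a"
      using le_id decreases_to_zero_nonneg[OF z a] by (auto simp: operator_le_def image_subset_iff)
    moreover have "T (x - f a) \<le> T (z a)" "T (- (x - f a)) \<le> T (z a)"
      using bound a by (auto intro: linear_positive_mono[OF lin pos])
    ultimately show ?thesis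
      by (auto simp: linear_diff[OF lin] intro: order_trans)
  qed
  with z show "order_converges A r (\<lambda>a. T (f a)) (T x)"
    by (auto simp: order_converges_def)
qed

theorem corollary16:
  fixes P :: "'x::ordered_real_vector \<Rightarrow> 'x"
  assumes "archimedean TYPE('x)"
    and "pre_Riesz TYPE('x) TYPE('y::{ordered_real_vector, lattice})"
    and "order_projection P"
  shows "order_continuous TYPE('i) P"
  using assms(3) order_continuous_if_between_zero_and_id
  by (auto simp: order_projection_def)

end
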